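(* Let $n\ge 3$ and let $n=p_1^{n_1}p_2^{n_2}\cdots p_t^{n_t}$ be the canonical decomposition of $n$ into prime factors. Then, for the cycle $C_n$ of length $n$: (i) if $n$ is odd, $$\mathfrak{D}_k(C_n)=\sum_{\mathcal{A}\subseteq\{1,2,\ldots,t\}}(-1)^{|\mathcal{A}|}\left(k^{n_{\mathcal{A}}}-n\,k^{\frac{n_{\mathcal{A}}+1}{2}}\right);$$ (ii) if $n$ is even, $$\mathfrak{D}_k(C_n)=\sum_{\mathcal{A}\subseteq\{1,2,\ldots,t\}}(-1)^{|\mathcal{A}|}\left(k^{n_{\mathcal{A}}}-\frac{n}{2}\,k^{\lceil\frac{n_{\mathcal{A}}+1}{2}\rceil}-\frac{n}{2}\,k^{\lfloor\frac{n_{\mathcal{A}}+1}{2}\rfloor}\right).$$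
   Context: For a finite simple graph $G$, a $k$-coloring is any map $c:V(G)\to\{1,\dots,k\}$; it is distinguishing if the only automorphism $f$ of $G$ with $c(f(v))=c(v)$ for all $v\in V(G)$ is the identity. $\mathfrak{D}_k(G)$ is the number of distinguishing maps $c:V(G)\to\{1,\dots,k\}$ (a polynomial in $k$, called the distinguishing polynomial of $G$). For $\mathcal{A}\subseteq W=\{1,2,\ldots,t\}$, define $$n_{\mathcal{A}}=\Big(\prod_{i\in W\setminus\mathcal{A}}p_i^{n_i}\Big)\Big(\prod_{j\in\mathcal{A}}p_j^{n_j-1}\Big),$$ so $n_\emptyset=n$. The sums run over all subsets $\mathcal{A}$ including the empty set. *)

theory Defs
  imports Complex_Main "HOL-Library.FuncSet" "HOL-Computational_Algebra.Primes"
begin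

record 'a ugraph =
  verts :: "'a set"
  edges :: "'a set set"

definition simple_graph :: "'a ugraph \<Rightarrow> bool" where
  "simple_graph G \<longleftrightarrow> finite (verts G) \<and> (\<forall>e\<in>edges G. e \<subseteq> verts G \<and> card e = 2)"

text \<open>The values of \<open>f\<close> outside \<open>verts G\<close> are irrelevant, so automorphisms are
  compared on \<open>verts G\<close> only.\<close>

definition automorphism :: "'a ugraph \<Rightarrow> ('a \<Rightarrow> 'a) \<Rightarrow> bool" where
  "automorphism G f \<longleftrightarrow> bij_betw f (verts G) (verts G) \<and>
     (\<forall>u\<in>verts G. \<forall>v\<in>verts G. {f u, f v} \<in> edges G \<longleftrightarrow> {u, v} \<in> edges G)"

definition distinguishing :: "'a ugraph \<Rightarrow> ('a \<Rightarrow> nat) \<Rightarrow> bool" where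
  "distinguishing G c \<longleftrightarrow>
     (\<forall>f. automorphism G f \<longrightarrow> (\<forall>v\<in>verts G. c (f v) = c v) \<longrightarrow> (\<forall>v\<in>verts G. f v = v))"

text \<open>The extensional function space \<open>\<rightarrow>\<^sub>E\<close> contains each map
  \<open>verts G \<rightarrow> {1,\<dots>,k}\<close> exactly once. Colorings need not be proper.\<close>

definition num_distinguishing :: "nat \<Rightarrow> 'a ugraph \<Rightarrow> nat" where
  "num_distinguishing k G = card {c \<in> verts G \<rightarrow>\<^sub>E {1..k}. distinguishing G c}"

definition cycle_graph :: "nat \<Rightarrow> nat ugraph" where
  "cycle_graph n = \<lparr>verts = {0..<n}, edges = {{i, (i + 1) mod n} |i. i < n}\<rparr>"

lemma simple_graph_cycle_graph:
  assumes "n \<ge> 3"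
  shows "simple_graph (cycle_graph n)"
proof -
  have "i \<noteq> Suc i mod n" if "i < n" for i
    using assms that by (cases "Suc i = n") auto
  then show ?thesis
    using assms by (auto simp: simple_graph_def cycle_graph_def card_insert_if)
qed

text \<open>The number \<open>n\<^sub>A\<close> attached to \<open>n = p\<^sub>1 ^ e\<^sub>1 \<cdots> p\<^sub>t ^ e\<^sub>t\<close> and
  \<open>A \<subseteq> {1,\<dots>,t}\<close>; the subtraction is not truncated when all exponents are positive.\<close>

definition reduced :: "(nat \<Rightarrow> nat) \<Rightarrow> (nat \<Rightarrow> nat) \<Rightarrow> nat \<Rightarrow> nat set \<Rightarrow> nat" where
  "reduced p e t A = (\<Prod>i\<in>{1..t} - A. p i ^ e i) * (\<Prod>j\<in>A. p j ^ (e j - 1))"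

end

theory Submission
  imports Defs "HOL-Number_Theory.Cong"
begin

text \<open>
  A coloring of \<open>C\<^sub>n\<close> is read as an \<open>n\<close>-periodic map on the integers. Since every automorphism of
  \<open>C\<^sub>n\<close> is \<open>i \<mapsto> a + i\<close> or \<open>i \<mapsto> a - i\<close>, it is distinguishing iff all its periods are multiples of
  \<open>n\<close> and it is not symmetric under any reflection \<open>x \<mapsto> s - x\<close>. The periods of a map are closed
  under \<open>gcd\<close>, so having no proper period means avoiding the periods \<open>n / p\<^sub>i\<close>, and inclusion-exclusion
  over these produces the numbers \<open>n\<^sub>A\<close>. The maps with a reflection symmetry are subtracted one
  reflection at a time, by the same inclusion-exclusion. The \<open>d\<close>-periodic maps symmetric under
  \<open>x \<mapsto> s - x\<close> are counted by the orbits of that reflection on the residues modulo \<open>d\<close>; their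
  number depends on the parity of \<open>s\<close> only when \<open>d\<close> is even.
\<close>

section \<open>Counting tools: inclusion-exclusion and maps that factor through a retraction\<close>

text \<open>Removing one more set \<open>Y i\<close> loses what the remaining removals leave of
  \<open>X \<inter> Y i\<close>. The induction hypothesis is thus needed for both \<open>X\<close>
  and \<open>X \<inter> Y i\<close>, so \<open>X\<close> stays arbitrary; adjoining \<open>i\<close>
  to an index set flips the sign.\<close>

lemma card_Diff_UN_incl_excl:
  assumes "finite I" "finite X"
  shows "real (card (X - (\<Union>i\<in>I. Y i))) =
    (\<Sum>A\<in>Pow I. (- 1) ^ card A * real (card (X \<inter> (\<Inter>i\<in>A. Y i))))"
  using assms
proof (induction I arbitrary: X rule: finite_induct)
  case empty
  then show ?case by simp
next
  case (insert i I)
  let ?U = "\<Union>i\<in>I. Y i"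
  have inj: "inj_on (insert i) (Pow I)"
    using insert.hyps by (auto simp: inj_on_def)
  have disj: "Pow I \<inter> insert i ` Pow I = {}"
    using insert.hyps by auto
  have "X - (\<Union>j\<in>insert i I. Y j) = (X - ?U) - (X \<inter> Y i - ?U)"
    by auto
  moreover have "card ((X - ?U) - (X \<inter> Y i - ?U)) = card (X - ?U) - card (X \<inter> Y i - ?U)"
    using insert.prems by (intro card_Diff_subset) auto
  moreover have "card (X \<inter> Y i - ?U) \<le> card (X - ?U)"
    using insert.prems by (intro card_mono) auto
  ultimately have "real (card (X - (\<Union>j\<in>insert i I. Y j))) =
      real (card (X - ?U)) - real (card (X \<inter> Y i - ?U))"
    by simp
  also have "\<dots> = (\<Sum>A\<in>Pow I. (- 1) ^ card A * real (card (X \<inter> (\<Inter>i\<in>A. Y i)))) -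
      (\<Sum>A\<in>Pow I. (- 1) ^ card A * real (card (X \<inter> Y i \<inter> (\<Inter>i\<in>A. Y i))))"
    using insert.prems by (simp add: insert.IH)
  also have "(\<Sum>A\<in>Pow I. (- 1) ^ card A * real (card (X \<inter> Y i \<inter> (\<Inter>i\<in>A. Y i)))) =
      - (\<Sum>A\<in>insert i ` Pow I. (- 1) ^ card A * real (card (X \<inter> (\<Inter>i\<in>A. Y i))))"
  proof -
    have "card (insert i A) = Suc (card A)" if "A \<in> Pow I" for A
      using that insert.hyps by (subst card_insert_disjoint) (auto intro: finite_subset)
    then show ?thesis
      by (simp add: sum.reindex[OF inj] Int_assoc flip: sum_negf)
  qed
  finally show ?case
    using insert.hyps disj by (simp add: Pow_insert sum.union_disjoint)
qed

text \<open>A map invariant under replacing \<open>x\<close> by its representative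
  \<open>i (r x)\<close> is determined by its values on the representatives, and these are free.
  This counts periodic maps (representatives are residues) and symmetric ones (representatives of
  orbits).\<close>

lemma bij_betw_comp_retraction:
  assumes "range r \<subseteq> T" "\<And>x. x \<in> T \<Longrightarrow> r (i x) = x"
  shows "bij_betw (\<lambda>h. h \<circ> r) (T \<rightarrow>\<^sub>E B) {g. range g \<subseteq> B \<and> (\<forall>x. g (i (r x)) = g x)}"
proof (rule bij_betw_byWitness[where f' = "\<lambda>g. restrict (g \<circ> i) T"])
  show "\<forall>h\<in>T \<rightarrow>\<^sub>E B. restrict (h \<circ> r \<circ> i) T = h"
    using assms(2) by (fastforce simp: fun_eq_iff restrict_def PiE_def extensional_def)
  show "\<forall>g\<in>{g. range g \<subseteq> B \<and> (\<forall>x. g (i (r x)) = g x)}. restrict (g \<circ> i) T \<circ> r = g"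
    using assms(1) by (auto simp: fun_eq_iff)
  have mem: "r x \<in> T" for x
    using assms(1) by auto
  then have "r (i (r x)) = r x" for x
    by (simp add: assms(2))
  then show "(\<lambda>h. h \<circ> r) ` (T \<rightarrow>\<^sub>E B) \<subseteq> {g. range g \<subseteq> B \<and> (\<forall>x. g (i (r x)) = g x)}"
    using mem by auto
  show "(\<lambda>g. restrict (g \<circ> i) T) ` {g. range g \<subseteq> B \<and> (\<forall>x. g (i (r x)) = g x)} \<subseteq> T \<rightarrow>\<^sub>E B"
    by auto
qed

subsection \<open>Periodic and symmetric maps on the integers\<close>

text \<open>The shift is an integer so that the periods of a map form a subgroup of the integers.
  The range condition makes the set finite for positive \<open>d\<close>; \<open>mirror\<close>
  leaves it out, as it only selects among maps that already satisfy it.\<close>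

definition periodic :: "nat \<Rightarrow> int \<Rightarrow> (int \<Rightarrow> nat) set" where
  "periodic k d = {g. range g \<subseteq> {1..k} \<and> (\<forall>x. g (x + d) = g x)}"

definition mirror :: "int \<Rightarrow> (int \<Rightarrow> nat) set" where
  "mirror s = {g. \<forall>x. g (s - x) = g x}"

lemma periodic_mult:
  assumes "g \<in> periodic k d"
  shows "g (x + m * d) = g x"
proof -
  have step: "g (y + d) = g y" for y
    using assms by (simp add: periodic_def)
  show ?thesis
  proof (induction m rule: int_induct[where k = 0])
    case (step1 i)
    then show ?case using step[of "x + i * d"] by (simp add: algebra_simps)
  next
    case (step2 i)
    then show ?case using step[of "x + (i - 1) * d"] by (simp add: algebra_simps)
  qed simp
qed

lemma periodic_cong:
  assumes "g \<in> periodic k d" "[x = y] (mod d)"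
  shows "g x = g y"
proof -
  obtain m where "y = x + m * d"
    using assms(2) by (metis cong_iff_lin mult.commute)
  then show ?thesis using periodic_mult[OF assms(1)] by simp
qed

lemma periodic_dvd:
  assumes "g \<in> periodic k d" "d dvd d'"
  shows "g \<in> periodic k d'"
  using assms periodic_mult[OF assms(1)]
  by (auto simp: periodic_def dvd_def mult.commute)

text \<open>By Bezout, the gcd is an integer combination of the two periods.\<close>

lemma periodic_gcd:
  assumes "g \<in> periodic k a" "g \<in> periodic k b"
  shows "g \<in> periodic k (gcd a b)"
proof -
  obtain u v where "u * a + v * b = gcd a b"
    using bezout_int by blast
  then have "g (x + gcd a b) = g x" for x
    using periodic_mult[OF assms(1), of x u] periodic_mult[OF assms(2), of "x + u * a" v]
    by (simp add: add.assoc)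
  then show ?thesis
    using assms by (auto simp: periodic_def)
qed

lemma periodic_Int: "periodic k a \<inter> periodic k b = periodic k (gcd a b)"
  by (blast intro: periodic_gcd periodic_dvd[OF _ gcd_dvd1] periodic_dvd[OF _ gcd_dvd2])

lemma periodic_eq_retraction:
  assumes "d > 0"
  shows "periodic k (int d) =
    {g. range g \<subseteq> {1..k} \<and> (\<forall>x. g (int (nat (x mod int d))) = g x)}"
proof -
  have "(\<forall>x. g (x + int d) = g x) \<longleftrightarrow> (\<forall>x. g (x mod int d) = g x)"
    if "range g \<subseteq> {1..k}" for g :: "int \<Rightarrow> nat"
  proof
    assume "\<forall>x. g (x + int d) = g x"
    with that have "g \<in> periodic k (int d)" by (simp add: periodic_def)
    then show "\<forall>x. g (x mod int d) = g x"
      by (auto intro!: periodic_cong[of g])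
  next
    assume "\<forall>x. g (x mod int d) = g x"
    then show "\<forall>x. g (x + int d) = g x"
      by (metis mod_add_self2)
  qed
  then show ?thesis
    using assms by (auto simp: periodic_def)
qed

text \<open>For \<open>d = n\<close> this is the passage from colorings of the cycle to periodic
  maps on the integers.\<close>

lemma bij_betw_periodic:
  assumes "d > 0"
  shows "bij_betw (\<lambda>c x. c (nat (x mod int d))) ({0..<d} \<rightarrow>\<^sub>E {1..k}) (periodic k (int d))"
proof -
  have "range (\<lambda>x. nat (x mod int d)) \<subseteq> {0..<d}"
    using assms by (auto simp: nat_less_iff)
  from bij_betw_comp_retraction[OF this, of int] show ?thesis
    using assms by (simp add: periodic_eq_retraction comp_def)
qed

lemma finite_periodic: "d > 0 \<Longrightarrow> finite (periodic k (int d))"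
  using bij_betw_finite[OF bij_betw_periodic[of d k]] by (simp add: finite_PiE)

lemma card_periodic: "d > 0 \<Longrightarrow> card (periodic k (int d)) = k ^ d"
  using bij_betw_same_card[OF bij_betw_periodic[of d k]] by (simp add: card_funcsetE)

text \<open>The orbit of \<open>x\<close> under \<open>x \<mapsto> x + d\<close> and \<open>x \<mapsto> s - x\<close> is represented by the smaller of
  \<open>x mod d\<close> and \<open>(s - x) mod d\<close>.\<close>

lemma card_periodic_mirror_aux:
  fixes d m :: nat and s :: int
  assumes "d > 0"
    and less: "\<And>x. min (x mod int d) ((s - x) mod int d) < int m"
    and repr: "\<And>x. 0 \<le> x \<Longrightarrow> x < int m \<Longrightarrow> x < int d \<and> x \<le> (s - x) mod int d"
  shows "card (periodic k (int d) \<inter> mirror s) = k ^ m"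
proof -
  define r where "r x = min (x mod int d) ((s - x) mod int d)" for x
  have r_nonneg: "0 \<le> r x" for x
    using assms(1) by (simp add: r_def)
  have r_sym: "r (s - x) = r x" for x
    by (simp add: r_def min.commute)
  have r_per: "r (x + int d) = r x" for x
  proof -
    have "(s - (x + int d)) mod int d = (s - x) mod int d"
      by (metis diff_diff_add minus_mod_self2)
    then show ?thesis by (simp add: r_def)
  qed
  have "range (\<lambda>x. nat (r x)) \<subseteq> {0..<m}"
    using less r_nonneg by (auto simp: r_def nat_less_iff)
  moreover have "nat (r (int x)) = x" if "x \<in> {0..<m}" for x
    using repr[of "int x"] that by (simp add: r_def)
  ultimately have "bij_betw (\<lambda>h. h \<circ> (\<lambda>x. nat (r x))) ({0..<m} \<rightarrow>\<^sub>E {1..k})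
      {g. range g \<subseteq> {1..k} \<and> (\<forall>x. g (int (nat (r x))) = g x)}"
    by (rule bij_betw_comp_retraction)
  moreover have "{g. range g \<subseteq> {1..k} \<and> (\<forall>x. g (int (nat (r x))) = g x)} =
      periodic k (int d) \<inter> mirror s" (is "?L = ?R")
  proof (intro equalityI subsetI)
    fix g assume "g \<in> ?L"
    then have rng: "range g \<subseteq> {1..k}" and g: "g (r x) = g x" for x
      using r_nonneg by auto
    have "g (x + int d) = g x" "g (s - x) = g x" for x
      using g[of "x + int d"] g[of "s - x"] g[of x] by (simp_all add: r_per r_sym)
    with rng show "g \<in> ?R" by (auto simp: periodic_def mirror_def)
  next
    fix g assume g: "g \<in> ?R"
    then have per: "g \<in> periodic k (int d)" by simp
    \<comment> \<open>Whichever of the two residues attains the minimum \<open>r x\<close>, it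
      carries the value \<open>g x\<close>.\<close>
    have "g (x mod int d) = g x" "g ((s - x) mod int d) = g x" for x
      using g periodic_cong[OF per, of "x mod int d" x]
        periodic_cong[OF per, of "(s - x) mod int d" "s - x"]
      by (simp_all add: mirror_def)
    then have "g (r x) = g x" for x
      by (simp add: r_def min_def)
    with g show "g \<in> ?L"
      using r_nonneg by (auto simp: periodic_def)
  qed
  ultimately show ?thesis
    by (auto dest!: bij_betw_same_card simp: card_funcsetE)
qed

text \<open>Negation modulo \<open>d\<close> fixes 0 and, for even \<open>d\<close>, also
  \<open>d / 2\<close>; the other residues pair up. The orbits are represented by 0 up to
  \<open>d div 2\<close>.\<close>

lemma card_periodic_mirror_0:
  assumes "d > 0"
  shows "card (periodic k (int d) \<inter> mirror 0) = k ^ ((d + 2) div 2)"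
proof (rule card_periodic_mirror_aux[OF assms])
  fix x :: int
  show "min (x mod int d) ((0 - x) mod int d) < int ((d + 2) div 2)"
    using assms pos_mod_bound[of "int d" x]
    by (auto simp: zmod_zminus1_eq_if min_def)
  assume "0 \<le> x" "x < int ((d + 2) div 2)"
  moreover from this have "x < int d" using assms by (cases "d = 1") auto
  ultimately show "x < int d \<and> x \<le> (0 - x) mod int d"
    by (auto simp: zmod_zminus1_eq_if)
qed

text \<open>The value -1 is a convenient odd \<open>s\<close>: the reflection just reverses the list
  of residues from 0 to \<open>d - 1\<close>, without wrapping around. The first half, with the
  middle residue for odd \<open>d\<close>, represents the orbits.\<close>

lemma card_periodic_mirror_1:
  assumes "d > 0"
  shows "card (periodic k (int d) \<inter> mirror (- 1)) = k ^ ((d + 1) div 2)"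
proof -
  have refl: "(- 1 - x) mod int d = int d - 1 - x mod int d" for x
  proof (rule int_mod_pos_eq)
    show "- 1 - x = int d * (- 1 - x div int d) + (int d - 1 - x mod int d)"
      by (simp add: algebra_simps)
  qed (use assms pos_mod_bound[of "int d" x] pos_mod_sign[of "int d" x] in \<open>simp_all del: pos_mod_sign\<close>)
  show ?thesis
  proof (rule card_periodic_mirror_aux[OF assms])
    fix x :: int
    show "min (x mod int d) ((- 1 - x) mod int d) < int ((d + 1) div 2)"
      unfolding refl by auto
    assume "0 \<le> x" "x < int ((d + 1) div 2)"
    moreover from this have "x < int d" using assms by auto
    ultimately show "x < int d \<and> x \<le> (- 1 - x) mod int d"
      unfolding refl by auto
  qed
qed

text \<open>Translating the argument by \<open>m\<close> moves the center of the reflection and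
  changes \<open>s\<close> by \<open>2 * m\<close>, so only the parity of \<open>s\<close>
  matters.\<close>

lemma card_periodic_mirror_shift:
  "card (periodic k d \<inter> mirror (s + 2 * m)) = card (periodic k d \<inter> mirror s)"
proof (rule bij_betw_same_card, rule bij_betw_byWitness)
  let ?f = "\<lambda>a (g :: int \<Rightarrow> nat) x. g (x + a)"
  have shift: "?f a g \<in> periodic k d \<inter> mirror (t - 2 * a)"
    if "g \<in> periodic k d \<inter> mirror t" for a g t
  proof -
    have per: "g (x + d) = g x" and mir: "g (t - x) = g x" for x
      using that by (auto simp: periodic_def mirror_def)
    have "g (x + d + a) = g (x + a)" "g (t - 2 * a - x + a) = g (x + a)" for x
      using per[of "x + a"] mir[of "x + a"] by (simp_all add: algebra_simps)
    then show ?thesis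
      using that by (auto simp: periodic_def mirror_def)
  qed
  show "?f m ` (periodic k d \<inter> mirror (s + 2 * m)) \<subseteq> periodic k d \<inter> mirror s"
    using shift[of _ "s + 2 * m" m] by auto
  show "?f (- m) ` (periodic k d \<inter> mirror s) \<subseteq> periodic k d \<inter> mirror (s + 2 * m)"
    using shift[of _ s "- m"] by auto
qed auto

lemma card_periodic_mirror:
  assumes "d > 0"
  shows "card (periodic k (int d) \<inter> mirror s) =
    k ^ (if even s then (d + 2) div 2 else (d + 1) div 2)"
proof (cases "even s")
  case True
  then obtain m where "s = 0 + 2 * m" by auto
  then show ?thesis
    using True card_periodic_mirror_shift[of k "int d" 0 m] card_periodic_mirror_0[OF assms] by simp
next
  case False
  then obtain m where "s = 2 * m + 1" by (rule oddE)
  then have "s = - 1 + 2 * (m + 1)" by simp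
  then show ?thesis
    using False card_periodic_mirror_shift[of k "int d" "- 1" "m + 1"]
      card_periodic_mirror_1[OF assms] by simp
qed

subsection \<open>Automorphisms and distinguishing colorings of the cycle\<close>

lemma cycle_graph_adjacent:
  assumes "u < n" "v < n"
  shows "{u, v} \<in> edges (cycle_graph n) \<longleftrightarrow>
    [int v = int u + 1] (mod int n) \<or> [int u = int v + 1] (mod int n)"
proof -
  have "{u, v} \<in> edges (cycle_graph n) \<longleftrightarrow> v = (u + 1) mod n \<or> u = (v + 1) mod n"
    using assms by (auto simp: cycle_graph_def doubleton_eq_iff)
  moreover have "y = (x + 1) mod n \<longleftrightarrow> [int y = int x + 1] (mod int n)" if "y < n" for x y
    using that by (metis cong_def cong_int_iff mod_less of_nat_1 of_nat_add)
  ultimately show ?thesis using assms by simp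
qed

text \<open>Adjacent vertices go to adjacent ones, so every step of \<open>f\<close> is +1 or -1
  modulo \<open>n\<close>. A change of direction would give \<open>f (i + 2) = f i\<close>, against
  injectivity; the first step therefore fixes the direction \<open>\<epsilon>\<close> for
  good.\<close>

lemma automorphism_cycle_graphE:
  assumes "n \<ge> 3" "automorphism (cycle_graph n) f"
  obtains a \<epsilon> :: int where "\<epsilon> \<in> {1, - 1}" "\<And>i. i < n \<Longrightarrow> [int (f i) = a + \<epsilon> * int i] (mod int n)"
proof -
  have bij: "bij_betw f {0..<n} {0..<n}"
    using assms(2) by (simp add: automorphism_def cycle_graph_def)
  then have inj: "inj_on f {0..<n}"
    by (rule bij_betw_imp_inj_on)
  have lt: "f i < n" if "i < n" for i
    using bij_betwE[OF bij] that by simp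
  have neighbour: "\<exists>\<delta>\<in>{1, - 1}. [int (f (Suc i)) = int (f i) + \<delta>] (mod int n)" if "Suc i < n" for i
  proof -
    have "{i, Suc i} \<in> edges (cycle_graph n)"
      using that by (subst cycle_graph_adjacent) (auto simp: add.commute)
    then have "{f i, f (Suc i)} \<in> edges (cycle_graph n)"
      using assms(2) that by (simp add: automorphism_def cycle_graph_def)
    then have "[int (f (Suc i)) = int (f i) + 1] (mod int n) \<or>
        [int (f i) = int (f (Suc i)) + 1] (mod int n)"
      using that by (subst (asm) cycle_graph_adjacent) (auto intro: lt)
    then show ?thesis
      by (auto simp: cong_iff_dvd_diff algebra_simps dvd_diff_commute)
  qed
  obtain \<epsilon> where \<epsilon>: "\<epsilon> \<in> {1, - 1 :: int}" "[int (f 1) = int (f 0) + \<epsilon>] (mod int n)"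
    using neighbour[of 0] assms(1) unfolding One_nat_def by (metis Suc_le_eq Suc_leD numeral_3_eq_3)
  \<comment> \<open>Two consecutive values are carried along, because ruling out a turn needs the
    value two vertices back.\<close>
  have pair: "[int (f i) = int (f 0) + \<epsilon> * int i] (mod int n) \<and>
      [int (f (Suc i)) = int (f 0) + \<epsilon> * int (Suc i)] (mod int n)" if "Suc i < n" for i
    using that
  proof (induction i)
    case 0
    then show ?case using \<epsilon>(2) by simp
  next
    case (Suc i)
    then have IH: "[int (f i) = int (f 0) + \<epsilon> * int i] (mod int n)"
        "[int (f (Suc i)) = int (f 0) + \<epsilon> * int (Suc i)] (mod int n)"
      by simp_all
    obtain \<delta> where \<delta>: "\<delta> \<in> {1, - 1 :: int}"
        "[int (f (Suc (Suc i))) = int (f (Suc i)) + \<delta>] (mod int n)"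
      using neighbour[OF Suc.prems] by blast
    have eq: "[int (f (Suc (Suc i))) = int (f 0) + \<epsilon> * int (Suc i) + \<delta>] (mod int n)"
      using \<delta>(2) IH(2) by (meson cong_add cong_refl cong_trans)
    have "\<delta> = \<epsilon>"
    proof (rule ccontr)
      assume "\<delta> \<noteq> \<epsilon>"
      then have "\<delta> = - \<epsilon>" using \<delta>(1) \<epsilon>(1) by auto
      with eq have "[int (f (Suc (Suc i))) = int (f 0) + \<epsilon> * int i] (mod int n)"
        by (simp add: algebra_simps)
      with IH(1) have "[f (Suc (Suc i)) = f i] (mod n)"
        by (meson cong_int_iff cong_sym cong_trans)
      then have "f (Suc (Suc i)) = f i"
        using Suc.prems by (simp add: cong_def lt)
      then have "Suc (Suc i) = i"
        by (rule inj_onD[OF inj]) (use Suc.prems in simp_all)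
      then show False by simp
    qed
    with eq IH(2) show ?case by (simp add: algebra_simps)
  qed
  have "[int (f i) = int (f 0) + \<epsilon> * int i] (mod int n)" if "i < n" for i
  proof (cases i)
    case 0
    then show ?thesis using pair[of 0] assms(1) by simp
  next
    case (Suc j)
    then show ?thesis using pair[of j] that by simp
  qed
  with \<epsilon>(1) show thesis by (rule that)
qed

text \<open>Conversely, multiplication by \<open>\<epsilon>\<close> is invertible modulo
  \<open>n\<close> and maps the differences +1 and -1 among themselves. This supplies the rotations
  and reflections against which a distinguishing coloring is tested.\<close>

lemma automorphism_cycle_graphI:
  assumes "n > 0" "\<epsilon> \<in> {1, - 1 :: int}"
  shows "automorphism (cycle_graph n) (\<lambda>i. nat ((a + \<epsilon> * int i) mod int n))"
    (is "automorphism _ ?f")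
proof -
  have f: "int (?f i) = (a + \<epsilon> * int i) mod int n" for i
    using assms(1) by simp
  have lt: "?f i < n" for i
    using assms(1) by (simp add: nat_less_iff)
  have "i = j" if "i < n" "j < n" "?f i = ?f j" for i j
  proof -
    have "[a + \<epsilon> * int i = a + \<epsilon> * int j] (mod int n)"
      using that(3) f by (metis cong_def)
    then have "[int i = int j] (mod int n)"
      using assms(2) by (auto simp: cong_iff_dvd_diff dvd_diff_commute)
    then show ?thesis
      using that by (simp add: cong_int_iff cong_def)
  qed
  then have "inj_on ?f {0..<n}"
    by (auto intro!: inj_onI)
  moreover from this have "?f ` {0..<n} = {0..<n}"
    using lt by (intro endo_inj_surj) auto
  ultimately have "bij_betw ?f {0..<n} {0..<n}"
    by (simp add: bij_betw_def)
  moreover have "{?f u, ?f v} \<in> edges (cycle_graph n) \<longleftrightarrow> {u, v} \<in> edges (cycle_graph n)"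
    if "u < n" "v < n" for u v
  proof -
    have "[int (?f y) = int (?f x) + 1] (mod int n) \<longleftrightarrow>
        [a + \<epsilon> * int y = a + \<epsilon> * int x + 1] (mod int n)" for x y
      unfolding f by (simp add: cong_def mod_simps)
    then show ?thesis
      using assms(2) that lt
      by (auto simp: cycle_graph_adjacent cong_iff_dvd_diff algebra_simps dvd_diff_commute)
  qed
  ultimately show ?thesis
    by (simp add: automorphism_def cycle_graph_def)
qed

text \<open>The maps whose group of periods is exactly the multiples of \<open>n\<close>.\<close>

definition primitive :: "nat \<Rightarrow> nat \<Rightarrow> (int \<Rightarrow> nat) set" where
  "primitive k n = {g \<in> periodic k (int n). \<forall>a. g \<in> periodic k a \<longrightarrow> int n dvd a}"

text \<open>Color-preserving automorphisms correspond to symmetries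
  \<open>x \<mapsto> a + \<epsilon> * x\<close> of \<open>g\<close>: periods for
  \<open>\<epsilon> = 1\<close>, reflections for \<open>\<epsilon> = - 1\<close>. As
  \<open>g\<close> is \<open>n\<close>-periodic, a reflection matters only through \<open>s\<close>
  modulo \<open>n\<close>.\<close>

lemma distinguishing_cycle_graph_iff:
  assumes "n \<ge> 3" "c \<in> {0..<n} \<rightarrow>\<^sub>E {1..k}" and g_def: "g = (\<lambda>x. c (nat (x mod int n)))"
  shows "distinguishing (cycle_graph n) c \<longleftrightarrow>
    g \<in> primitive k n - (\<Union>s\<in>{0..<int n}. mirror s)"
proof
  have per: "g \<in> periodic k (int n)"
    using bij_betw_imp_surj_on[OF bij_betw_periodic[of n k]] assms by (auto simp: g_def)
  have trivial: "\<epsilon> = 1 \<and> int n dvd a"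
    if "distinguishing (cycle_graph n) c" "\<epsilon> \<in> {1, - 1}" and inv: "\<And>x. g (a + \<epsilon> * x) = g x" for a \<epsilon>
  proof -
    have "nat ((a + \<epsilon> * int i) mod int n) = i" if "i < n" for i
      using \<open>distinguishing (cycle_graph n) c\<close>[unfolded distinguishing_def, rule_format,
          OF automorphism_cycle_graphI[of n \<epsilon> a], of i]
        \<open>\<epsilon> \<in> {1, - 1}\<close> inv[of "int _"] \<open>i < n\<close> assms(1)
      by (auto simp: cycle_graph_def g_def)
    then have "(a + \<epsilon> * int i) mod int n = int i mod int n" if "i < n" for i
      using that assms(1) by (metis mod_less nat_0_le of_nat_mod pos_mod_sign of_nat_0_less_iff gr_implies_not0 neq0_conv)
    then have "int n dvd a + \<epsilon> * int i - int i" if "i < n" for i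
      using that by (metis mod_eq_dvd_iff)
    \<comment> \<open>Vertex 0 forces \<open>n\<close> to divide \<open>a\<close>, and vertex 1 then
      forces it to divide \<open>\<epsilon> - 1\<close>; \<open>\<epsilon> = - 1\<close> would make
      \<open>n\<close> a divisor of 2.\<close>
    from this[of 0] this[of 1] have "int n dvd a" "int n dvd a + \<epsilon> - 1"
      using assms(1) by simp_all
    moreover from this have "int n dvd \<epsilon> - 1"
      by (metis add_diff_eq dvd_add_right_iff)
    ultimately show ?thesis
      using assms(1) \<open>\<epsilon> \<in> {1, - 1}\<close> zdvd_imp_le[of "int n" 2] by auto
  qed
  {
    assume "distinguishing (cycle_graph n) c"
    note trivial = trivial[OF this]
    have "int n dvd a" if "g \<in> periodic k a" for a
    proof -
      have "g (a + 1 * x) = g x" for x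
        using that by (simp add: periodic_def add.commute[of a])
      then show ?thesis using trivial[of 1 a] by blast
    qed
    moreover have "g \<notin> mirror s" for s
    proof
      assume "g \<in> mirror s"
      then have "g (s + - 1 * x) = g x" for x
        by (simp add: mirror_def)
      then show False using trivial[of "- 1" s] by force
    qed
    ultimately show "g \<in> primitive k n - (\<Union>s\<in>{0..<int n}. mirror s)"
      using per by (auto simp: primitive_def)
  }
  assume g: "g \<in> primitive k n - (\<Union>s\<in>{0..<int n}. mirror s)"
  show "distinguishing (cycle_graph n) c"
    unfolding distinguishing_def
  proof (intro allI impI ballI)
    fix f v
    assume f: "automorphism (cycle_graph n) f" "\<forall>v\<in>verts (cycle_graph n). c (f v) = c v"
      and v: "v \<in> verts (cycle_graph n)"
    obtain \<epsilon> a where \<epsilon>: "\<epsilon> \<in> {1, - 1}"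
      and cong: "\<And>i. i < n \<Longrightarrow> [int (f i) = a + \<epsilon> * int i] (mod int n)"
      using assms(1) f(1) by (rule automorphism_cycle_graphE) (rule that)
    have lt: "f i < n" if "i < n" for i
      using f(1) that by (auto simp: automorphism_def cycle_graph_def bij_betw_def)
    \<comment> \<open>Invariance is known only at vertices; periodicity carries it to every integer
      through its residue \<open>i\<close>.\<close>
    have inv: "g (a + \<epsilon> * x) = g x" for x
    proof -
      define i where "i = nat (x mod int n)"
      have i: "i < n" "[int i = x] (mod int n)"
        using assms(1) by (auto simp: i_def nat_less_iff)
      have "[a + \<epsilon> * x = int (f i)] (mod int n)"
        using cong[OF i(1)] i(2) by (meson cong_add cong_mult cong_refl cong_sym cong_trans)
      then have "g (a + \<epsilon> * x) = g (int (f i))"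
        by (rule periodic_cong[OF per])
      also have "\<dots> = c (f i)"
        using lt[OF i(1)] by (simp add: g_def)
      also have "\<dots> = g x"
        using f(2) i(1) by (simp add: cycle_graph_def i_def g_def)
      finally show ?thesis .
    qed
    show "f v = v"
    proof (cases "\<epsilon> = 1")
      case True
      then have "g (x + a) = g x" for x
        using inv[of x] by (simp add: add.commute)
      then have "g \<in> periodic k a"
        using per by (simp add: periodic_def)
      then have "int n dvd a"
        using g by (auto simp: primitive_def)
      then have "[a + \<epsilon> * int v = int v] (mod int n)"
        by (simp add: True cong_iff_dvd_diff)
      then have "[int (f v) = int v] (mod int n)"
        using cong[of v] v by (auto simp: cycle_graph_def intro: cong_trans)
      then show ?thesis
        using v lt[of v] by (simp add: cong_int_iff cong_def cycle_graph_def)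
    next
      case False
      \<comment> \<open>The center is reduced modulo \<open>n\<close> to fall among the excluded
        reflections.\<close>
      have "g (a mod int n - x) = g x" for x
      proof -
        have "g (a mod int n - x) = g (a - x)"
          by (simp add: g_def mod_simps)
        then show ?thesis using inv[of x] False \<epsilon> by simp
      qed
      then have "g \<in> mirror (a mod int n)"
        by (simp add: mirror_def)
      then show ?thesis
        using g assms(1) by auto
    qed
  qed
qed

lemma num_distinguishing_cycle_graph:
  assumes "n \<ge> 3"
  shows "num_distinguishing k (cycle_graph n) =
    card (primitive k n - (\<Union>s\<in>{0..<int n}. mirror s))"
proof -
  define \<Phi> :: "(nat \<Rightarrow> nat) \<Rightarrow> int \<Rightarrow> nat" where "\<Phi> c = (\<lambda>x. c (nat (x mod int n)))" for c
  define D where "D = primitive k n - (\<Union>s\<in>{0..<int n}. mirror s)"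
  let ?F = "{0..<n} \<rightarrow>\<^sub>E {1..k}"
  let ?C = "{c \<in> ?F. distinguishing (cycle_graph n) c}"
  have bij: "bij_betw \<Phi> ?F (periodic k (int n))"
    using assms bij_betw_periodic[of n k] by (simp add: \<Phi>_def[abs_def])
  have "distinguishing (cycle_graph n) c \<longleftrightarrow> \<Phi> c \<in> D" if "c \<in> ?F" for c
    unfolding D_def by (rule distinguishing_cycle_graph_iff[OF assms that \<Phi>_def])
  then have "?C = {c \<in> ?F. \<Phi> c \<in> D}"
    by blast
  then have "\<Phi> ` ?C = D \<inter> \<Phi> ` ?F"
    by blast
  also have "\<dots> = D"
    unfolding bij_betw_imp_surj_on[OF bij] by (auto simp: D_def primitive_def)
  finally have "bij_betw \<Phi> ?C D"
    by (intro bij_betw_subset[OF bij]) auto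
  then show ?thesis
    by (simp add: num_distinguishing_def cycle_graph_def D_def bij_betw_same_card)
qed

text \<open>Two distinct reflections compose to a nontrivial rotation, so a map without a proper
  period is symmetric under at most one reflection.\<close>

lemma card_primitive_diff_mirror:
  assumes "n > 0"
  shows "real (card (primitive k n - (\<Union>s\<in>{0..<int n}. mirror s))) =
    real (card (primitive k n)) - (\<Sum>s\<in>{0..<int n}. real (card (primitive k n \<inter> mirror s)))"
proof -
  have fin: "finite (primitive k n)"
    using finite_periodic[OF assms] by (simp add: primitive_def)
  have "s = s'" if "g \<in> primitive k n" "g \<in> mirror s" "g \<in> mirror s'" "s \<in> {0..<int n}" "s' \<in> {0..<int n}"
    for g s s'
  proof -
    have "g (x + (s - s')) = g x" for x
    proof -
      have "g (s - (s' - x)) = g (s' - x)" "g (s' - x) = g x"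
        using that by (auto simp: mirror_def)
      then show ?thesis by (simp add: algebra_simps)
    qed
    then have "g \<in> periodic k (s - s')"
      using that(1) by (auto simp: primitive_def periodic_def)
    then have "[s = s'] (mod int n)"
      using that(1) by (simp add: primitive_def cong_iff_dvd_diff)
    then show ?thesis
      using that by (simp add: cong_def)
  qed
  then have "card (\<Union>s\<in>{0..<int n}. primitive k n \<inter> mirror s) =
      (\<Sum>s\<in>{0..<int n}. card (primitive k n \<inter> mirror s))"
    using fin by (intro card_UN_disjoint) auto
  moreover have "primitive k n - (\<Union>s\<in>{0..<int n}. mirror s) =
      primitive k n - (\<Union>s\<in>{0..<int n}. primitive k n \<inter> mirror s)"
    by auto
  moreover have "card (\<Union>s\<in>{0..<int n}. primitive k n \<inter> mirror s) \<le> card (primitive k n)"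
    using fin by (intro card_mono) auto
  moreover have "card (primitive k n - (\<Union>s\<in>{0..<int n}. primitive k n \<inter> mirror s)) =
      card (primitive k n) - card (\<Union>s\<in>{0..<int n}. primitive k n \<inter> mirror s)"
    using fin by (intro card_Diff_subset finite_subset[OF _ fin]) auto
  ultimately show ?thesis by simp
qed

subsection \<open>Inclusion-exclusion over proper periods\<close>

text \<open>This is \<open>n\<^sub>A = n / (\<Prod>j\<in>A. p j)\<close> without division; positive
  exponents keep \<open>e j - 1\<close> from truncating.\<close>

lemma reduced_mult_prod:
  assumes "A \<subseteq> {1..t}" "\<And>i. i \<in> {1..t} \<Longrightarrow> e i \<ge> 1"
  shows "reduced p e t A * (\<Prod>j\<in>A. p j) = (\<Prod>i\<in>{1..t}. p i ^ e i)"
proof -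
  have "(\<Prod>j\<in>A. p j ^ (e j - 1)) * (\<Prod>j\<in>A. p j) = (\<Prod>j\<in>A. p j ^ e j)"
    unfolding prod.distrib[symmetric]
  proof (intro prod.cong refl)
    fix j assume "j \<in> A"
    then have "e j \<ge> 1" using assms by auto
    then show "p j ^ (e j - 1) * p j = p j ^ e j"
      by (cases "e j") auto
  qed
  then show ?thesis
    using prod.subset_diff[OF assms(1), of "\<lambda>i. p i ^ e i"]
    by (simp add: reduced_def mult.assoc)
qed

text \<open>Common periods are governed by gcds, and \<open>n\<^sub>A\<close> is the gcd of
  \<open>n\<close> and all \<open>n div p i\<close> with \<open>i\<close> in \<open>A\<close>. For a
  new index \<open>i\<close>, the two numbers to combine are \<open>m * p i\<close> and
  \<open>m * P\<close>, where \<open>P\<close> is the product of the earlier primes and hence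
  coprime to \<open>p i\<close>.\<close>

lemma periodic_INT_reduced:
  assumes "A \<subseteq> {1..t}"
    and prime: "\<And>i. i \<in> {1..t} \<Longrightarrow> prime (p i)" and "inj_on p {1..t}"
    and e: "\<And>i. i \<in> {1..t} \<Longrightarrow> e i \<ge> 1" and n: "n = (\<Prod>i\<in>{1..t}. p i ^ e i)"
  shows "periodic k (int n) \<inter> (\<Inter>i\<in>A. periodic k (int (n div p i))) =
    periodic k (int (reduced p e t A))"
proof -
  have "finite A" using assms(1) by (rule finite_subset) simp
  then show ?thesis
    using assms(1)
  proof (induction A rule: finite_induct)
    case empty
    then show ?case by (simp add: reduced_def n)
  next
    case (insert i A)
    define m P where "m = reduced p e t (insert i A)" and "P = (\<Prod>j\<in>A. p j)"
    have i: "i \<in> {1..t}" and A: "A \<subseteq> {1..t}" using insert.prems by auto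
    have P: "P > 0"
      unfolding P_def using A prime by (intro prod_pos) (auto simp: prime_gt_0_nat subset_iff)
    have n1: "n = m * (p i * P)"
      using reduced_mult_prod[OF insert.prems, of e p, OF e] insert.hyps by (simp add: n m_def P_def)
    have "reduced p e t A * P = n"
      using reduced_mult_prod[OF A, of e p, OF e] by (simp add: n P_def)
    then have red: "reduced p e t A = m * p i"
      using n1 P by (simp add: ac_simps)
    have div: "n div p i = m * P"
      using n1 prime[OF i] by (simp add: prime_gt_0_nat)
    have "coprime (p i) P"
      unfolding P_def
    proof (rule prod_coprime_right)
      fix j assume "j \<in> A"
      then have j: "j \<in> {1..t}" "i \<noteq> j"
        using A insert.hyps by auto
      then have "p i \<noteq> p j"
        by (simp add: inj_on_eq_iff[OF assms(3) i])
      then show "coprime (p i) (p j)"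
        by (rule primes_coprime[OF prime[OF i] prime[OF j(1)]])
    qed
    then have "gcd (m * p i) (m * P) = m"
      by (simp add: gcd_mult_left)
    then have "gcd (int (reduced p e t A)) (int (n div p i)) = int m"
      by (simp add: red div flip: of_nat_mult)
    then have "periodic k (int (reduced p e t A)) \<inter> periodic k (int (n div p i)) = periodic k (int m)"
      by (simp only: periodic_Int)
    then show ?case
      using insert.IH[OF A] unfolding m_def INT_insert by blast
  qed
qed

text \<open>No \<open>n div p i\<close> is a multiple of \<open>n\<close>. Conversely, a period
  \<open>a\<close> outside the multiples of \<open>n\<close> yields the period
  \<open>d = gcd n a\<close>, a proper divisor of \<open>n\<close>; some \<open>p i\<close> divides
  the cofactor \<open>q\<close>, so \<open>d\<close> divides \<open>n div p i\<close>, which is then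
  a period too.\<close>

lemma primitive_eq_diff:
  fixes n t :: nat
  assumes prime: "\<And>i. i \<in> {1..t} \<Longrightarrow> prime (p i)" and n: "n = (\<Prod>i\<in>{1..t}. p i ^ e i)"
    and e: "\<And>i. i \<in> {1..t} \<Longrightarrow> e i \<ge> 1"
  shows "primitive k n = periodic k (int n) - (\<Union>i\<in>{1..t}. periodic k (int (n div p i)))"
proof (intro equalityI subsetI)
  have "n > 0"
    unfolding n using prime by (intro prod_pos) (auto simp: prime_gt_0_nat)
  {
    fix g assume g: "g \<in> primitive k n"
    have False if "i \<in> {1..t}" "g \<in> periodic k (int (n div p i))" for i
    proof -
      have "p i dvd n"
      proof (rule dvd_trans)
        show "p i dvd p i ^ e i" using e[OF that(1)] by simp
        show "p i ^ e i dvd n"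
          unfolding n by (rule dvd_prodI) (use that(1) in simp_all)
      qed
      then obtain c where c: "n = p i * c" by (rule dvdE)
      have "int n dvd int (n div p i)"
        using g that(2) unfolding primitive_def by blast
      then have "n dvd n div p i"
        by (simp only: of_nat_dvd_iff)
      then have "p i * c dvd c"
        using c prime_gt_0_nat[OF prime[OF that(1)]] by simp
      then show False
        using c \<open>n > 0\<close> prime_gt_1_nat[OF prime[OF that(1)]] by simp
    qed
    then show "g \<in> periodic k (int n) - (\<Union>i\<in>{1..t}. periodic k (int (n div p i)))"
      using g unfolding primitive_def by blast
  }
  fix g assume g: "g \<in> periodic k (int n) - (\<Union>i\<in>{1..t}. periodic k (int (n div p i)))"
  have "int n dvd a" if a: "g \<in> periodic k a" for a
  proof (rule ccontr)
    assume "\<not> int n dvd a"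
    define d where "d = nat (gcd (int n) a)"
    have d: "int d = gcd (int n) a" by (simp add: d_def)
    then have "g \<in> periodic k (int d)"
      using g a by (simp add: periodic_gcd)
    have "d dvd n"
      using d by (metis gcd_dvd1 of_nat_dvd_iff)
    then obtain q where q: "n = d * q" by auto
    have "q \<noteq> 1"
      using \<open>\<not> int n dvd a\<close> d q by (metis gcd_dvd2 mult.right_neutral)
    then obtain r where r: "prime r" "r dvd q"
      using prime_factor_nat by blast
    then have "r dvd (\<Prod>i\<in>{1..t}. p i ^ e i)"
      using q n by simp
    then obtain i where i: "i \<in> {1..t}" "r dvd p i ^ e i"
      using r(1) by (auto simp: prime_dvd_prod_iff)
    then have "r = p i"
      using r(1) prime by (meson prime_dvd_power primes_dvd_imp_eq)
    then obtain s where "q = p i * s"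
      using r(2) by auto
    then have "n div p i = d * s"
      using q prime_gt_0_nat[OF prime[OF i(1)]] by simp
    then have "d dvd n div p i" by simp
    then have "g \<in> periodic k (int (n div p i))"
      using \<open>g \<in> periodic k (int d)\<close> by (auto intro: periodic_dvd)
    then show False using g i by auto
  qed
  then show "g \<in> primitive k n"
    using g by (simp add: primitive_def)
qed

section \<open>Summing over the reflections and splitting by the parity of \<open>n\<close>\<close>

lemma sum_parity_int:
  fixes a b :: real
  shows "(\<Sum>s\<in>{0..<int (2 * m)}. if even s then a else b) = real m * (a + b)"
proof (induction m)
  case (Suc m)
  have "{0..<int (2 * Suc m)} = insert (int (2 * m)) (insert (int (2 * m) + 1) {0..<int (2 * m)})"
    by auto
  then show ?case using Suc by (simp add: algebra_simps)
qed simp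

lemma num_distinguishing_cycle_graph_eq_sum:
  assumes "n \<ge> 3"
    and "\<And>i. i \<in> {1..t} \<Longrightarrow> prime (p i)" "inj_on p {1..t}"
    and "\<And>i. i \<in> {1..t} \<Longrightarrow> e i \<ge> 1" "n = (\<Prod>i\<in>{1..t}. p i ^ e i)"
  shows "real (num_distinguishing k (cycle_graph n)) =
    (\<Sum>A\<in>Pow {1..t}. (- 1) ^ card A * (real k ^ reduced p e t A -
      (\<Sum>s\<in>{0..<int n}. if even s then real k ^ ((reduced p e t A + 2) div 2)
         else real k ^ ((reduced p e t A + 1) div 2))))"
proof -
  let ?Y = "\<lambda>i. periodic k (int (n div p i))"
  let ?r = "reduced p e t"
  have "n > 0" using assms(1) by simp
  have pos: "?r A > 0" if "A \<subseteq> {1..t}" for A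
    using reduced_mult_prod[OF that, of e p, OF assms(4)] assms(5) \<open>n > 0\<close> by (metis gr0I mult_0)
  have prim: "primitive k n = periodic k (int n) - (\<Union>i\<in>{1..t}. ?Y i)"
    using assms(2,5,4) by (rule primitive_eq_diff)
  have INT: "periodic k (int n) \<inter> (\<Inter>i\<in>A. ?Y i) = periodic k (int (?r A))" if "A \<subseteq> {1..t}" for A
    using that assms(2-5) by (rule periodic_INT_reduced)
  have "real (card (primitive k n)) =
      (\<Sum>A\<in>Pow {1..t}. (- 1) ^ card A * real (card (periodic k (int n) \<inter> (\<Inter>i\<in>A. ?Y i))))"
    unfolding prim using finite_periodic[OF \<open>n > 0\<close>] by (intro card_Diff_UN_incl_excl) auto
  also have "\<dots> = (\<Sum>A\<in>Pow {1..t}. (- 1) ^ card A * real k ^ ?r A)"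
    by (intro sum.cong refl) (simp add: INT pos card_periodic)
  finally have prim_card: "real (card (primitive k n)) = \<dots>" .
  have mirror_card: "real (card (primitive k n \<inter> mirror s)) = (\<Sum>A\<in>Pow {1..t}. (- 1) ^ card A *
      (if even s then real k ^ ((?r A + 2) div 2) else real k ^ ((?r A + 1) div 2)))" for s
  proof -
    \<comment> \<open>Symmetry under a fixed reflection is imposed on the ambient set, so the same
      inclusion-exclusion over periods applies.\<close>
    have "primitive k n \<inter> mirror s = periodic k (int n) \<inter> mirror s - (\<Union>i\<in>{1..t}. ?Y i)"
      unfolding prim by auto
    also have "real (card \<dots>) = (\<Sum>A\<in>Pow {1..t}. (- 1) ^ card A *
        real (card (periodic k (int n) \<inter> mirror s \<inter> (\<Inter>i\<in>A. ?Y i))))"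
      using finite_periodic[OF \<open>n > 0\<close>] by (intro card_Diff_UN_incl_excl) auto
    also have "\<dots> = (\<Sum>A\<in>Pow {1..t}. (- 1) ^ card A *
        (if even s then real k ^ ((?r A + 2) div 2) else real k ^ ((?r A + 1) div 2)))"
    proof (intro sum.cong refl)
      fix A assume "A \<in> Pow {1..t}"
      then have A: "A \<subseteq> {1..t}" by simp
      have "periodic k (int n) \<inter> mirror s \<inter> (\<Inter>i\<in>A. ?Y i) = periodic k (int (?r A)) \<inter> mirror s"
        using INT[OF A] by blast
      then show "(- 1) ^ card A * real (card (periodic k (int n) \<inter> mirror s \<inter> (\<Inter>i\<in>A. ?Y i))) =
          (- 1) ^ card A *
            (if even s then real k ^ ((?r A + 2) div 2) else real k ^ ((?r A + 1) div 2))"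
        using card_periodic_mirror[OF pos[OF A]] by simp
    qed
    finally show ?thesis .
  qed
  show ?thesis
    unfolding num_distinguishing_cycle_graph[OF assms(1)]
      card_primitive_diff_mirror[OF \<open>n > 0\<close>] prim_card mirror_card
    by (subst sum.swap) (simp add: sum_distrib_left right_diff_distrib sum_subtractf)
qed

theorem theorem2p8:
  fixes n t k :: nat and p e :: "nat \<Rightarrow> nat"
  assumes "n \<ge> 3"
    and "\<And>i. i \<in> {1..t} \<Longrightarrow> prime (p i)"
    and "inj_on p {1..t}"
    and "\<And>i. i \<in> {1..t} \<Longrightarrow> e i \<ge> 1"
    and "n = (\<Prod>i\<in>{1..t}. p i ^ e i)"
  shows "(odd n \<longrightarrow>
      real (num_distinguishing k (cycle_graph n)) =
        (\<Sum>A\<in>Pow {1..t}. (- 1) ^ card A *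
          (real k ^ reduced p e t A - real n * real k ^ ((reduced p e t A + 1) div 2)))) \<and>
    (even n \<longrightarrow>
      real (num_distinguishing k (cycle_graph n)) =
        (\<Sum>A\<in>Pow {1..t}. (- 1) ^ card A *
          (real k ^ reduced p e t A
            - real n / 2 * real k ^ nat \<lceil>(real (reduced p e t A) + 1) / 2\<rceil>
            - real n / 2 * real k ^ nat \<lfloor>(real (reduced p e t A) + 1) / 2\<rfloor>)))"
proof (intro conjI impI)
  let ?r = "reduced p e t"
  have count: "real (num_distinguishing k (cycle_graph n)) =
    (\<Sum>A\<in>Pow {1..t}. (- 1) ^ card A * (real k ^ ?r A -
      (\<Sum>s\<in>{0..<int n}. if even s then real k ^ ((?r A + 2) div 2)
         else real k ^ ((?r A + 1) div 2))))"
    using assms by (rule num_distinguishing_cycle_graph_eq_sum)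
  {
    assume "odd n"
    have "(\<Sum>s\<in>{0..<int n}. if even s then real k ^ ((?r A + 2) div 2)
        else real k ^ ((?r A + 1) div 2)) = real n * real k ^ ((?r A + 1) div 2)"
      if "A \<in> Pow {1..t}" for A
    proof -
      \<comment> \<open>\<open>n\<^sub>A\<close> divides the odd \<open>n\<close>; for odd
        \<open>n\<^sub>A\<close> both kinds of reflection give the same exponent.\<close>
      have "odd (?r A)"
        using reduced_mult_prod[of A t e p] assms(4,5) that \<open>odd n\<close> by (metis PowD even_mult_iff)
      then obtain q where "?r A = 2 * q + 1" by (rule oddE)
      then have "(?r A + 2) div 2 = (?r A + 1) div 2" by simp
      then show ?thesis by (simp only: if_cancel) simp
    qed
    then show "real (num_distinguishing k (cycle_graph n)) = (\<Sum>A\<in>Pow {1..t}. (- 1) ^ card A *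
        (real k ^ ?r A - real n * real k ^ ((?r A + 1) div 2)))"
      unfolding count by (intro sum.cong refl) simp
  }
  assume "even n"
  then obtain m where m: "n = 2 * m" by auto
  \<comment> \<open>Even \<open>s\<close> accounts for the ceiling term and odd \<open>s\<close> for
    the floor term; for even \<open>n\<close> each parity occurs \<open>n / 2\<close> times.\<close>
  have "\<lceil>(real r + 1) / 2\<rceil> = int ((r + 2) div 2)" "\<lfloor>(real r + 1) / 2\<rfloor> = int ((r + 1) div 2)" for r :: nat
    by (rule ceiling_unique floor_unique; cases "even r"; auto elim!: evenE oddE)+
  then have "nat \<lceil>(real r + 1) / 2\<rceil> = (r + 2) div 2" "nat \<lfloor>(real r + 1) / 2\<rfloor> = (r + 1) div 2" for r :: nat
    by simp_all
  then show "real (num_distinguishing k (cycle_graph n)) = (\<Sum>A\<in>Pow {1..t}. (- 1) ^ card A *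
      (real k ^ ?r A - real n / 2 * real k ^ nat \<lceil>(real (?r A) + 1) / 2\<rceil>
        - real n / 2 * real k ^ nat \<lfloor>(real (?r A) + 1) / 2\<rfloor>))"
    unfolding count unfolding m unfolding sum_parity_int by (intro sum.cong refl) (simp add: algebra_simps)
qed

end
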